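(* Let $d\in\{2,3\}$, and for $L\ge 0$ consider the finite element spaces $\mathcal{V}_0\subset\cdots\subset\mathcal{V}_L\subset H^1_\#(Y)$ and the macrogrid hierarchy $S_0,\dots,S_L$ described in the context. The total number of degrees of freedom required to solve the cell problem at all points of $S_0,S_1,\dots,S_L$ is $\mathcal{O}((L+1)2^{dL})$ for the hierarchical solve (in which the problem at each point of $S_l$ is solved in the space $\mathcal{V}_{L-l}$), while it is $\mathcal{O}((2^{dL})^2)$ for the full solve (in which the cell problems at all macrogrid points are solved in the finest space $\mathcal{V}_L$). The implied constants are independent of $L$.
   Context: $Y$ is the unit cube in $\mathbb{R}^d$ and $H^1_\#(Y)$ the space of $Y$-periodic $H^1$ functions. Macrogrids: $\mathcal{T}_0\subset\mathcal{T}_1\subset\cdots\subset\mathcal{T}_L\subset\Omega\subset\mathbb{R}^d$, where $\mathcal{T}_l$ has grid spacing $H2^{-l}$, $S_0=\mathcal{T}_0$ and $S_l=\mathcal{T}_l\setminus\bigcup_{k<l}S_k$; the number of points of $S_l$ is $\mathcal{O}(2^{dl})$. The nested finite element spaces $\mathcal{V}_0\subset\cdots\subset\mathcal{V}_L$ satisfy $\dim\mathcal{V}_m=\mathcal{O}(2^{dm})$. (All implied constants are independent of $l,m,L$.) The cell problem at a macroscopic point $x$ (for each $i=1,\dots,d$) is the coupled periodic system for a pair $(N_1^i,N_2^i)$, $$\mathrm{div}_y(\kappa_1(x,y)(e^i+\nabla_yN_1^i))+Q(x,y)(N_2^i-N_1^i)=0,\qquad \mathrm{div}_y(\kappa_2(x,y)(e^i+\nabla_yN_2^i))+Q(x,y)(N_1^i-N_2^i)=0.$$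 In the hierarchical solve, at a point of $S_0$ a Galerkin problem for this system is solved with both components in $\mathcal{V}_L$, and at a point of $S_l$, $l\ge1$, a single Galerkin problem for a correction pair is solved with both components in $\mathcal{V}_{L-l}$ (for each $i$). In the full solve, at every point of $S_0\cup\dots\cup S_L$ a Galerkin problem with both components in $\mathcal{V}_L$ is solved. The number of degrees of freedom for one Galerkin problem with both components in $\mathcal{V}_m$ is the dimension $2\dim\mathcal{V}_m$ of its trial space, and the total number of degrees of freedom is the sum over all macroscopic points (and all $i$) of these numbers. *)

theory Defs
  imports "HOL-Analysis.Analysis"
begin

definition partial_deriv :: "'n::finite \<Rightarrow> (real ^ 'n \<Rightarrow> real) \<Rightarrow> real ^ 'n \<Rightarrow> real" where
  "partial_deriv i f x = deriv (\<lambda>t. f (x + t *\<^sub>R axis i 1)) 0"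

text \<open>Smoothness: all iterated partial derivatives are totally differentiable everywhere.\<close>

definition test_function :: "(real ^ 'n::finite \<Rightarrow> real) \<Rightarrow> bool" where
  "test_function \<phi> \<longleftrightarrow>
     (\<forall>is. fold partial_deriv is \<phi> differentiable_on UNIV) \<and> compact (closure {x. \<phi> x \<noteq> 0})"

definition locally_L2 :: "(real ^ 'n::finite \<Rightarrow> real) \<Rightarrow> bool" where
  "locally_L2 f \<longleftrightarrow> f \<in> borel_measurable lebesgue \<and>
     (\<forall>K. compact K \<longrightarrow> integrable (lebesgue_on K) (\<lambda>x. (f x)\<^sup>2))"

definition weak_deriv :: "'n::finite \<Rightarrow> (real ^ 'n \<Rightarrow> real) \<Rightarrow> (real ^ 'n \<Rightarrow> real) \<Rightarrow> bool" where
  "weak_deriv i u g \<longleftrightarrow> locally_L2 g \<and>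
     (\<forall>\<phi>. test_function \<phi> \<longrightarrow>
        (LINT x|lebesgue. u x * partial_deriv i \<phi> x) = - (LINT x|lebesgue. g x * \<phi> x))"

definition Y_periodic :: "(real ^ 'n::finite \<Rightarrow> real) \<Rightarrow> bool" where
  "Y_periodic f \<longleftrightarrow> (\<forall>i x. f (x + axis i 1) = f x)"

text \<open>For periodic functions, being locally H1 on the whole space is the same as being in
  H1(Y) with matching traces on opposite faces of Y.\<close>

definition H1_per_fun :: "(real ^ 'n::finite \<Rightarrow> real) set" where
  "H1_per_fun = {u. Y_periodic u \<and> locally_L2 u \<and> (\<forall>i. \<exists>g. weak_deriv i u g)}"

definition H1_per_eq :: "(real ^ 'n::finite \<Rightarrow> real) \<Rightarrow> (real ^ 'n \<Rightarrow> real) \<Rightarrow> bool" where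
  "H1_per_eq u v \<longleftrightarrow> u \<in> H1_per_fun \<and> v \<in> H1_per_fun \<and> (AE x in lebesgue. u x = v x)"

lemma test_function_bounds:
  assumes "test_function (\<phi> :: real ^ 'n::finite \<Rightarrow> real)"
  defines "K \<equiv> closure {x. \<phi> x \<noteq> 0}"
  shows "compact K" "continuous_on UNIV \<phi>" "continuous_on UNIV (partial_deriv i \<phi>)"
    "\<And>x. x \<notin> K \<Longrightarrow> \<phi> x = 0" "\<And>x. x \<notin> K \<Longrightarrow> partial_deriv i \<phi> x = 0"
proof -
  show "compact K" using assms by (simp add: test_function_def)
  have d: "fold partial_deriv is \<phi> differentiable_on UNIV" for "is"
    using assms by (simp add: test_function_def)
  show "continuous_on UNIV \<phi>"
    using d[of "[]"] by (simp add: differentiable_imp_continuous_on)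
  show "continuous_on UNIV (partial_deriv i \<phi>)"
    using d[of "[i]"] by (simp add: differentiable_imp_continuous_on)
  show z: "\<phi> x = 0" if "x \<notin> K" for x
    using that closure_subset[of "{x. \<phi> x \<noteq> 0}"] by (auto simp: K_def)
  show "partial_deriv i \<phi> x = 0" if "x \<notin> K" for x
  proof -
    have cont: "isCont (\<lambda>t::real. x + t *\<^sub>R (axis i 1 :: real^'n)) 0"
      by (intro continuous_intros)
    have "open (- K)" by (simp add: K_def open_Compl)
    then have "\<forall>\<^sub>F y in nhds x. y \<in> - K" using that eventually_nhds by blast
    moreover have "filterlim (\<lambda>t::real. x + t *\<^sub>R (axis i 1 :: real^'n)) (nhds x) (nhds 0)"
      using cont unfolding isCont_def by (simp add: tendsto_nhds_iff)
    ultimately have "\<forall>\<^sub>F t in nhds (0::real). x + t *\<^sub>R (axis i 1 :: real^'n) \<in> - K"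
      by (rule eventually_compose_filterlim)
    then have "\<forall>\<^sub>F t in nhds (0::real). \<phi> (x + t *\<^sub>R axis i 1) = 0"
      by eventually_elim (auto intro: z)
    then have "deriv (\<lambda>t. \<phi> (x + t *\<^sub>R axis i 1)) 0 = deriv (\<lambda>t::real. 0::real) 0"
      by (intro deriv_cong_ev) auto
    then show ?thesis by (simp add: partial_deriv_def)
  qed
qed

lemma locally_L2_integrable_mult:
  assumes "locally_L2 (u :: real ^ 'n::finite \<Rightarrow> real)" "compact K" "continuous_on UNIV \<psi>"
    "\<And>x. x \<notin> K \<Longrightarrow> \<psi> x = 0"
  shows "integrable lebesgue (\<lambda>x. u x * \<psi> x)"
proof -
  have K: "K \<in> sets lebesgue" "emeasure lebesgue K < \<infinity>"
    using fmeasurableD[OF lmeasurable_compact[OF assms(2)]]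
      fmeasurableD2[OF lmeasurable_compact[OF assms(2)]] by (auto simp: less_top)
  have m: "\<psi> \<in> borel_measurable lebesgue"
    using borel_measurable_continuous_onI[OF assms(3)] by (simp add: measurable_completion)
  have um: "u \<in> borel_measurable lebesgue" using assms(1) by (simp add: locally_L2_def)
  have "integrable (lebesgue_on K) (\<lambda>x. (u x)\<^sup>2)"
    using assms(1,2) by (simp add: locally_L2_def)
  then have iu: "integrable lebesgue (\<lambda>x. indicator K x *\<^sub>R (u x)\<^sup>2)"
    using K by (subst (asm) integrable_restrict_space) auto
  have c1: "integrable lebesgue (indicator K :: _ \<Rightarrow> real)"
    using K by (simp add: integrable_indicator_iff)
  have "bounded (\<psi> ` K)"
    using assms(2,3) by (meson compact_continuous_image compact_imp_bounded continuous_on_subset top_greatest)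
  then obtain B where B: "\<And>x. x \<in> K \<Longrightarrow> \<bar>\<psi> x\<bar> \<le> B"
    by (auto simp: bounded_iff)
  have "integrable lebesgue (\<lambda>x. \<bar>B\<bar> * (indicator K x + indicator K x *\<^sub>R (u x)\<^sup>2))"
    using c1 iu by (intro integrable_mult_right Bochner_Integration.integrable_add)
  then show ?thesis
  proof (rule Bochner_Integration.integrable_bound)
    show "(\<lambda>x. u x * \<psi> x) \<in> borel_measurable lebesgue" using um m by measurable
    show "AE x in lebesgue. norm (u x * \<psi> x)
        \<le> norm (\<bar>B\<bar> * (indicator K x + indicator K x *\<^sub>R (u x)\<^sup>2))"
    proof (rule AE_I2)
      fix x
      show "norm (u x * \<psi> x) \<le> norm (\<bar>B\<bar> * (indicator K x + indicator K x *\<^sub>R (u x)\<^sup>2))"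
      proof (cases "x \<in> K")
        case True
        have "\<bar>u x\<bar> \<le> 1 + (u x)\<^sup>2"
          using zero_le_power2[of "\<bar>u x\<bar> - 1"] by (auto simp: power2_eq_square algebra_simps)
        moreover have "\<bar>\<psi> x\<bar> \<le> \<bar>B\<bar>" using B[OF True] by simp
        ultimately have "\<bar>u x\<bar> * \<bar>\<psi> x\<bar> \<le> (1 + (u x)\<^sup>2) * \<bar>B\<bar>" by (intro mult_mono) auto
        then show ?thesis using True by (simp add: abs_mult mult.commute)
      qed (simp add: assms(4))
    qed
  qed
qed

lemma locally_L2_0: "locally_L2 (\<lambda>x. 0)"
  by (simp add: locally_L2_def)

lemma locally_L2_lincomb:
  assumes "locally_L2 u" "locally_L2 v"
  shows "locally_L2 (\<lambda>x. a * u x + b * v x :: real)"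
  unfolding locally_L2_def
proof (intro conjI allI impI)
  have m: "u \<in> borel_measurable lebesgue" "v \<in> borel_measurable lebesgue"
    using assms by (auto simp: locally_L2_def)
  show ml: "(\<lambda>x. a * u x + b * v x) \<in> borel_measurable lebesgue" using m by measurable
  fix K :: "(real^'a) set" assume K: "compact K"
  have i: "integrable (lebesgue_on K) (\<lambda>x. 2 * a\<^sup>2 * (u x)\<^sup>2 + 2 * b\<^sup>2 * (v x)\<^sup>2)"
    using assms K by (auto simp: locally_L2_def)
  show "integrable (lebesgue_on K) (\<lambda>x. (a * u x + b * v x)\<^sup>2)"
  proof (rule Bochner_Integration.integrable_bound[OF i])
    show "(\<lambda>x. (a * u x + b * v x)\<^sup>2) \<in> borel_measurable (lebesgue_on K)"
      using ml by (intro borel_measurable_power measurable_restrict_space1)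
    have "(s + t)\<^sup>2 \<le> 2 * s\<^sup>2 + 2 * t\<^sup>2" for s t :: real
      using zero_le_power2[of "s - t"] by (simp add: power2_eq_square algebra_simps)
    then have "(a * u x + b * v x)\<^sup>2 \<le> 2 * a\<^sup>2 * (u x)\<^sup>2 + 2 * b\<^sup>2 * (v x)\<^sup>2" for x
      by (metis mult.assoc power_mult_distrib)
    then show "AE x in lebesgue_on K. norm ((a * u x + b * v x)\<^sup>2)
        \<le> norm (2 * a\<^sup>2 * (u x)\<^sup>2 + 2 * b\<^sup>2 * (v x)\<^sup>2)"
      by (intro AE_I2) simp
  qed
qed

lemma weak_deriv_lincomb:
  assumes "locally_L2 u" "locally_L2 v" "weak_deriv i u g" "weak_deriv i v h"
  shows "weak_deriv i (\<lambda>x. a * u x + b * v x) (\<lambda>x. a * g x + b * h x)"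
  unfolding weak_deriv_def
proof (intro conjI allI impI)
  have g: "locally_L2 g" "locally_L2 h" using assms by (auto simp: weak_deriv_def)
  then show "locally_L2 (\<lambda>x. a * g x + b * h x)" by (rule locally_L2_lincomb)
  fix \<phi> :: "real ^ 'a \<Rightarrow> real" assume \<phi>: "test_function \<phi>"
  note b = test_function_bounds[OF \<phi>]
  have I: "integrable lebesgue (\<lambda>x. f x * partial_deriv i \<phi> x)" "integrable lebesgue (\<lambda>x. f x * \<phi> x)"
    if "locally_L2 f" for f
    using locally_L2_integrable_mult[OF that b(1) b(3) b(5)]
      locally_L2_integrable_mult[OF that b(1) b(2) b(4)] by blast+
  have lin: "(LINT x|lebesgue. (a * p x + b * q x) * r x)
      = a * (LINT x|lebesgue. p x * r x) + b * (LINT x|lebesgue. q x * r x)"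
    if "integrable lebesgue (\<lambda>x. p x * r x)" "integrable lebesgue (\<lambda>x. q x * r x)"
    for p q r :: "real ^ 'a \<Rightarrow> real"
    using that by (simp only: distrib_right mult.assoc Bochner_Integration.integral_add
        integrable_mult_right integral_mult_right_zero)
  have "(LINT x|lebesgue. u x * partial_deriv i \<phi> x) = - (LINT x|lebesgue. g x * \<phi> x)"
    "(LINT x|lebesgue. v x * partial_deriv i \<phi> x) = - (LINT x|lebesgue. h x * \<phi> x)"
    using assms(3,4) \<phi> by (simp_all add: weak_deriv_def)
  then show "(LINT x|lebesgue. (a * u x + b * v x) * partial_deriv i \<phi> x)
      = - (LINT x|lebesgue. (a * g x + b * h x) * \<phi> x)"
    unfolding lin[OF I(1)[OF assms(1)] I(1)[OF assms(2)]] lin[OF I(2)[OF g(1)] I(2)[OF g(2)]]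
    by simp
qed

lemma H1_per_fun_0: "(\<lambda>x. 0) \<in> H1_per_fun"
  by (auto simp: H1_per_fun_def Y_periodic_def locally_L2_0 weak_deriv_def
      intro!: exI[of _ "\<lambda>x. 0"])

lemma H1_per_fun_lincomb:
  assumes "u \<in> H1_per_fun" "v \<in> H1_per_fun"
  shows "(\<lambda>x. a * u x + b * v x) \<in> H1_per_fun"
  using assms unfolding H1_per_fun_def
  by (auto simp: Y_periodic_def locally_L2_lincomb) (blast intro: weak_deriv_lincomb)

lemma part_equivp_H1_per_eq: "part_equivp H1_per_eq"
proof (rule part_equivpI)
  show "\<exists>x::real ^ 'n::finite \<Rightarrow> real. H1_per_eq x x"
    using H1_per_fun_0 by (auto simp: H1_per_eq_def)
  show "symp (H1_per_eq :: (real ^ 'n \<Rightarrow> real) \<Rightarrow> _)"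
    by (auto simp: symp_def H1_per_eq_def eq_commute)
  show "transp (H1_per_eq :: (real ^ 'n \<Rightarrow> real) \<Rightarrow> _)"
    by (auto simp: transp_def H1_per_eq_def)
qed

quotient_type (overloaded) 'n H1_per = "real ^ ('n::finite) \<Rightarrow> real" / partial: H1_per_eq
  by (rule part_equivp_H1_per_eq)

instantiation H1_per :: (finite) real_vector
begin

lift_definition zero_H1_per :: "'a H1_per" is "\<lambda>x. 0"
  using H1_per_fun_0 by (simp add: H1_per_eq_def)

lift_definition plus_H1_per :: "'a H1_per \<Rightarrow> 'a H1_per \<Rightarrow> 'a H1_per" is "\<lambda>u v x. u x + v x"
  using H1_per_fun_lincomb[of _ _ 1 1] by (auto simp: H1_per_eq_def)

lift_definition minus_H1_per :: "'a H1_per \<Rightarrow> 'a H1_per \<Rightarrow> 'a H1_per" is "\<lambda>u v x. u x - v x"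
  using H1_per_fun_lincomb[of _ _ 1 "-1"] by (auto simp: H1_per_eq_def)

lift_definition uminus_H1_per :: "'a H1_per \<Rightarrow> 'a H1_per" is "\<lambda>u x. - u x"
  using H1_per_fun_lincomb[of _ _ "-1" 0] by (auto simp: H1_per_eq_def)

lift_definition scaleR_H1_per :: "real \<Rightarrow> 'a H1_per \<Rightarrow> 'a H1_per" is "\<lambda>c u x. c * u x"
  using H1_per_fun_lincomb[of _ _ _ 0] by (auto simp: H1_per_eq_def)

instance
proof
  note lin = H1_per_fun_lincomb
  have add: "(\<lambda>x. u x + v x) \<in> H1_per_fun" if "u \<in> H1_per_fun" "v \<in> H1_per_fun" for u v :: "real^'a \<Rightarrow> real"
    using lin[OF that, of 1 1] by simp
  have sc: "(\<lambda>x. c * u x) \<in> H1_per_fun" if "u \<in> H1_per_fun" for c and u :: "real^'a \<Rightarrow> real"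
    using lin[OF that that, of c 0] by simp
  fix a b c :: "'a H1_per" and s t :: real
  show "a + b + c = a + (b + c)"
    by transfer (auto simp: H1_per_eq_def add.assoc intro!: add)
  show "a + b = b + a"
    by transfer (auto simp: H1_per_eq_def add.commute intro!: add)
  show "0 + a = a" by transfer (auto simp: H1_per_eq_def)
  show "- a + a = 0" by transfer (auto simp: H1_per_eq_def H1_per_fun_0)
  show "a - b = a + - b"
    by transfer (use lin[of _ _ 1 "-1"] in \<open>auto simp: H1_per_eq_def\<close>)
  show "s *\<^sub>R (a + b) = s *\<^sub>R a + s *\<^sub>R b"
    by transfer (auto simp: H1_per_eq_def distrib_left intro!: lin)
  show "(s + t) *\<^sub>R a = s *\<^sub>R a + t *\<^sub>R a"
    by transfer (auto simp: H1_per_eq_def distrib_right intro!: lin)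
  show "s *\<^sub>R t *\<^sub>R a = (s * t) *\<^sub>R a"
    by transfer (auto simp: H1_per_eq_def mult.assoc intro!: sc[of _ "_ * _", unfolded mult.assoc])
  show "1 *\<^sub>R a = a" by transfer (auto simp: H1_per_eq_def)
qed

end

text \<open>A weak gradient of a representative; it is unique up to null sets, so that the integrals
  below do not depend on the choices.\<close>

definition grad :: "('n::finite) H1_per \<Rightarrow> real ^ 'n \<Rightarrow> real ^ 'n" where
  "grad u y = (\<chi> i. (SOME g. weak_deriv i (rep_H1_per u) g) y)"

record 'v galerkin_problem =
  trial_space :: "'v set"
  bilinear_form :: "'v \<Rightarrow> 'v \<Rightarrow> real"
  load :: "'v \<Rightarrow> real"

definition galerkin_solution :: "'v galerkin_problem \<Rightarrow> 'v \<Rightarrow> bool" where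
  "galerkin_solution P N \<longleftrightarrow> N \<in> trial_space P \<and>
     (\<forall>\<phi>\<in>trial_space P. bilinear_form P N \<phi> = load P \<phi>)"

definition dof :: "('v::real_vector) galerkin_problem \<Rightarrow> nat" where
  "dof P = dim (trial_space P)"

abbreviation Y_cube :: "(real ^ 'n::finite) set" where
  "Y_cube \<equiv> cbox 0 (\<chi> i. 1)"

text \<open>The weak form of the cell problem for \<open>e\<^sup>i\<close> at \<open>x\<close>, obtained by testing the first equation
  with \<open>\<phi>1\<close> and the second one with \<open>\<phi>2\<close> and integrating by parts over the periodicity cell, is
  \<open>cell_form \<kappa>1 \<kappa>2 Q x (N1, N2) (\<phi>1, \<phi>2) = cell_load \<kappa>1 \<kappa>2 x i (\<phi>1, \<phi>2)\<close>.
  The coefficients \<open>\<kappa>1\<close>, \<open>\<kappa>2\<close> are matrix valued; scalar ones are multiples of \<open>mat 1\<close>.\<close>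

definition cell_form ::
  "(real ^ 'n \<Rightarrow> real ^ 'n \<Rightarrow> real ^ 'n ^ 'n) \<Rightarrow> (real ^ 'n \<Rightarrow> real ^ 'n \<Rightarrow> real ^ 'n ^ 'n) \<Rightarrow>
   (real ^ 'n \<Rightarrow> real ^ 'n \<Rightarrow> real) \<Rightarrow> real ^ 'n \<Rightarrow>
   ('n::finite) H1_per \<times> 'n H1_per \<Rightarrow> 'n H1_per \<times> 'n H1_per \<Rightarrow> real" where
  "cell_form \<kappa>1 \<kappa>2 Q x = (\<lambda>(N1, N2) (\<phi>1, \<phi>2).
     LINT y|lebesgue_on Y_cube.
       (\<kappa>1 x y *v grad N1 y) \<bullet> grad \<phi>1 y + (\<kappa>2 x y *v grad N2 y) \<bullet> grad \<phi>2 y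
       - Q x y * (rep_H1_per N2 y - rep_H1_per N1 y) * rep_H1_per \<phi>1 y
       - Q x y * (rep_H1_per N1 y - rep_H1_per N2 y) * rep_H1_per \<phi>2 y)"

definition cell_load ::
  "(real ^ 'n \<Rightarrow> real ^ 'n \<Rightarrow> real ^ 'n ^ 'n) \<Rightarrow> (real ^ 'n \<Rightarrow> real ^ 'n \<Rightarrow> real ^ 'n ^ 'n) \<Rightarrow>
   real ^ 'n \<Rightarrow> 'n \<Rightarrow> ('n::finite) H1_per \<times> 'n H1_per \<Rightarrow> real" where
  "cell_load \<kappa>1 \<kappa>2 x i = (\<lambda>(\<phi>1, \<phi>2).
     - (LINT y|lebesgue_on Y_cube.
         (\<kappa>1 x y *v axis i 1) \<bullet> grad \<phi>1 y + (\<kappa>2 x y *v axis i 1) \<bullet> grad \<phi>2 y))"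

definition cell_galerkin ::
  "(real ^ 'n \<Rightarrow> real ^ 'n \<Rightarrow> real ^ 'n ^ 'n) \<Rightarrow> (real ^ 'n \<Rightarrow> real ^ 'n \<Rightarrow> real ^ 'n ^ 'n) \<Rightarrow>
   (real ^ 'n \<Rightarrow> real ^ 'n \<Rightarrow> real) \<Rightarrow> ('n::finite) H1_per set \<Rightarrow> real ^ 'n \<Rightarrow> 'n \<Rightarrow>
   ('n H1_per \<times> 'n H1_per) galerkin_problem" where
  "cell_galerkin \<kappa>1 \<kappa>2 Q V x i =
     \<lparr>trial_space = V \<times> V, bilinear_form = cell_form \<kappa>1 \<kappa>2 Q x, load = cell_load \<kappa>1 \<kappa>2 x i\<rparr>"

text \<open>The correction problem has the bilinear form of the cell problem; its right hand side \<open>F\<close>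
  encodes the solutions computed at points of coarser levels.\<close>

definition correction_galerkin ::
  "(real ^ 'n \<Rightarrow> real ^ 'n \<Rightarrow> real ^ 'n ^ 'n) \<Rightarrow> (real ^ 'n \<Rightarrow> real ^ 'n \<Rightarrow> real ^ 'n ^ 'n) \<Rightarrow>
   (real ^ 'n \<Rightarrow> real ^ 'n \<Rightarrow> real) \<Rightarrow> ('n H1_per \<times> 'n H1_per \<Rightarrow> real) \<Rightarrow>
   ('n::finite) H1_per set \<Rightarrow> real ^ 'n \<Rightarrow> ('n H1_per \<times> 'n H1_per) galerkin_problem" where
  "correction_galerkin \<kappa>1 \<kappa>2 Q F V x =
     \<lparr>trial_space = V \<times> V, bilinear_form = cell_form \<kappa>1 \<kappa>2 Q x, load = F\<rparr>"

text \<open>A grid need not occupy every lattice point of the domain. The second condition excludes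
  grids all of whose points lie on a coarser sublattice without adjacent points.\<close>

definition has_grid_spacing :: "(real ^ 'n::finite) set \<Rightarrow> real \<Rightarrow> bool" where
  "has_grid_spacing T h \<longleftrightarrow>
     (\<exists>x0. \<forall>x\<in>T. \<forall>i. \<exists>k::int. x $ i = x0 $ i + h * of_int k) \<and>
     ((\<exists>x\<in>T. \<exists>y\<in>T. x \<noteq> y) \<longrightarrow> (\<exists>x\<in>T. \<exists>y\<in>T. dist x y = h))"

fun level_points :: "(nat \<Rightarrow> 'a set) \<Rightarrow> nat \<Rightarrow> 'a set" where
  "level_points T l = T l - (\<Union>k\<in>{..<l}. level_points T k)"

declare level_points.simps [simp del]

definition hierarchical_problem ::
  "(real ^ 'n \<Rightarrow> real ^ 'n \<Rightarrow> real ^ 'n ^ 'n) \<Rightarrow> (real ^ 'n \<Rightarrow> real ^ 'n \<Rightarrow> real ^ 'n ^ 'n) \<Rightarrow>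
   (real ^ 'n \<Rightarrow> real ^ 'n \<Rightarrow> real) \<Rightarrow>
   (nat \<Rightarrow> real ^ 'n \<Rightarrow> 'n \<Rightarrow> 'n H1_per \<times> 'n H1_per \<Rightarrow> real) \<Rightarrow>
   (nat \<Rightarrow> ('n::finite) H1_per set) \<Rightarrow> nat \<Rightarrow> nat \<Rightarrow> real ^ 'n \<Rightarrow> 'n \<Rightarrow>
   ('n H1_per \<times> 'n H1_per) galerkin_problem" where
  "hierarchical_problem \<kappa>1 \<kappa>2 Q F V L l x i =
     (if l = 0 then cell_galerkin \<kappa>1 \<kappa>2 Q (V L) x i
      else correction_galerkin \<kappa>1 \<kappa>2 Q (F l x i) (V (L - l)) x)"

definition hierarchical_dof ::
  "(real ^ 'n \<Rightarrow> real ^ 'n \<Rightarrow> real ^ 'n ^ 'n) \<Rightarrow> (real ^ 'n \<Rightarrow> real ^ 'n \<Rightarrow> real ^ 'n ^ 'n) \<Rightarrow>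
   (real ^ 'n \<Rightarrow> real ^ 'n \<Rightarrow> real) \<Rightarrow>
   (nat \<Rightarrow> real ^ 'n \<Rightarrow> 'n \<Rightarrow> 'n H1_per \<times> 'n H1_per \<Rightarrow> real) \<Rightarrow>
   (nat \<Rightarrow> (real ^ 'n) set) \<Rightarrow> (nat \<Rightarrow> ('n::finite) H1_per set) \<Rightarrow> nat \<Rightarrow> nat" where
  "hierarchical_dof \<kappa>1 \<kappa>2 Q F T V L =
     (\<Sum>l\<le>L. \<Sum>x\<in>level_points T l. \<Sum>i\<in>UNIV. dof (hierarchical_problem \<kappa>1 \<kappa>2 Q F V L l x i))"

definition full_dof ::
  "(real ^ 'n \<Rightarrow> real ^ 'n \<Rightarrow> real ^ 'n ^ 'n) \<Rightarrow> (real ^ 'n \<Rightarrow> real ^ 'n \<Rightarrow> real ^ 'n ^ 'n) \<Rightarrow>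
   (real ^ 'n \<Rightarrow> real ^ 'n \<Rightarrow> real) \<Rightarrow>
   (nat \<Rightarrow> (real ^ 'n) set) \<Rightarrow> (nat \<Rightarrow> ('n::finite) H1_per set) \<Rightarrow> nat \<Rightarrow> nat" where
  "full_dof \<kappa>1 \<kappa>2 Q T V L =
     (\<Sum>x\<in>(\<Union>l\<le>L. level_points T l). \<Sum>i\<in>UNIV. dof (cell_galerkin \<kappa>1 \<kappa>2 Q (V L) x i))"

end

theory Submission
  imports Defs
begin

text \<open>
  Write \<open>q = 2\<^sup>d\<close>. In the hierarchical solve the growth of the number of points and the growth of
  the trial spaces run against each other: level \<open>l\<close> has \<open>O(q\<^sup>l)\<close> points, but each of them carries
  only \<open>O(q\<^sup>L\<^sup>-\<^sup>l)\<close> degrees of freedom, so that every level costs \<open>O(q\<^sup>L)\<close>, whatever \<open>l\<close> is. There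
  are \<open>L + 1\<close> levels, which gives the factor \<open>L + 1\<close>. In the full solve each point carries
  \<open>O(q\<^sup>L)\<close> degrees of freedom and the number of points is a geometric sum, dominated by
  its last term \<open>q\<^sup>L\<close>; this gives \<open>(q\<^sup>L)\<^sup>2\<close>.

  The one fact of linear algebra is that doubling the components at most doubles the dimension
  (\<open>dim_Times_le\<close>). The periodic Sobolev space is infinite dimensional and carries no norm here, so
  this is proved for finitely spanned sets in an arbitrary real vector space.
\<close>

text \<open>A basis of \<open>V\<close> and one of \<open>W\<close>, embedded in the two factors, span \<open>V \<times> W\<close> together. The
  ambient spaces need not be finite dimensional, so finiteness of the two bases comes from the
  finite spanning sets \<open>A\<close> and \<open>B\<close>.\<close>

lemma dim_Times_le:
  fixes V :: "'a::real_vector set" and W :: "'b::real_vector set"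
  assumes "finite A" "V \<subseteq> span A" "finite B" "W \<subseteq> span B"
  shows "dim (V \<times> W) \<le> dim V + dim W"
proof -
  obtain A' where A': "A' \<subseteq> V" "independent A'" "V \<subseteq> span A'" "card A' = dim V"
    by (rule real_vector.basis_exists)
  obtain B' where B': "B' \<subseteq> W" "independent B'" "W \<subseteq> span B'" "card B' = dim W"
    by (rule real_vector.basis_exists)
  have fin: "finite A'" "finite B'"
    using real_vector.independent_span_bound[OF assms(1) A'(2)] A'(1) assms(2)
      real_vector.independent_span_bound[OF assms(3) B'(2)] B'(1) assms(4) by auto
  define E where "E = (\<lambda>v. (v, 0 :: 'b)) ` A' \<union> (\<lambda>w. (0 :: 'a, w)) ` B'"
  have lin: "linear (\<lambda>v :: 'a. (v, 0 :: 'b))" "linear (\<lambda>w :: 'b. (0 :: 'a, w))"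
    by (auto intro!: linearI)
  have "V \<times> W \<subseteq> span E"
  proof clarify
    fix v w assume "v \<in> V" "w \<in> W"
    then have "(v, 0) \<in> span ((\<lambda>v. (v, 0 :: 'b)) ` A')" "(0, w) \<in> span ((\<lambda>w. (0 :: 'a, w)) ` B')"
      using A'(3) B'(3) unfolding linear_span_image[OF lin(1)] linear_span_image[OF lin(2)] by auto
    moreover have "span ((\<lambda>v. (v, 0 :: 'b)) ` A') \<subseteq> span E" "span ((\<lambda>w. (0 :: 'a, w)) ` B') \<subseteq> span E"
      by (intro span_mono; simp add: E_def)+
    ultimately have "(v, 0) \<in> span E" "(0, w) \<in> span E" by blast+
    then have "(v, 0) + (0, w) \<in> span E" by (rule span_add)
    then show "(v, w) \<in> span E" by simp
  qed
  then have "dim (V \<times> W) \<le> card E"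
    using fin by (intro real_vector.dim_le_card) (auto simp: E_def)
  also have "\<dots> \<le> card ((\<lambda>v. (v, 0 :: 'b)) ` A') + card ((\<lambda>w. (0 :: 'a, w)) ` B')"
    unfolding E_def by (rule card_Un_le)
  also have "\<dots> \<le> card A' + card B'"
    by (intro add_mono card_image_le fin)
  finally show ?thesis using A'(4) B'(4) by simp
qed

lemma dof_cell_galerkin_le:
  assumes "finite B" "V = span B"
  shows "dof (cell_galerkin \<kappa>1 \<kappa>2 Q V x i) \<le> 2 * dim V"
  using dim_Times_le[OF assms(1) _ assms(1), of V V] equalityD1[OF assms(2)]
  by (simp add: dof_def cell_galerkin_def)

lemma dof_hierarchical_problem_le:
  assumes "finite B" "V (L - l) = span B"
  shows "dof (hierarchical_problem \<kappa>1 \<kappa>2 Q F V L l x i) \<le> 2 * dim (V (L - l))"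
  using dim_Times_le[OF assms(1) _ assms(1), of "V (L - l)" "V (L - l)"]
    equalityD1[OF assms(2)]
  by (auto simp: dof_def hierarchical_problem_def cell_galerkin_def correction_galerkin_def)

lemma sum_powers_le_twice_last:
  fixes q :: real
  assumes "q \<ge> 2"
  shows "(\<Sum>l\<le>L. q ^ l) \<le> 2 * q ^ L"
proof (induction L)
  case (Suc L)
  have "2 * q ^ L \<le> q ^ Suc L" using assms by (simp add: mult_right_mono)
  then show ?case using Suc by simp
qed simp

text \<open>The powers \<open>q\<^sup>l\<close> from the points and \<open>q\<^sup>L\<^sup>-\<^sup>l\<close> from the trial space multiply to \<open>q\<^sup>L\<close> on every level.
  The constant is explicit, since the families of grids and spaces may change with \<open>L\<close> and the
  existence of some constant for each \<open>L\<close> would say nothing about uniformity.\<close>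

lemma hierarchical_dof_le:
  fixes V :: "nat \<Rightarrow> ('n::finite) H1_per set" and q :: real
  assumes "q \<ge> 0" "C \<ge> 0"
    and points: "\<And>l. l \<le> L \<Longrightarrow> real (card (level_points T l)) \<le> C * q ^ l"
    and spanned: "\<And>m. m \<le> L \<Longrightarrow> \<exists>B. finite B \<and> V m = span B"
    and dims: "\<And>m. m \<le> L \<Longrightarrow> real (dim (V m)) \<le> D * q ^ m"
  shows "real (hierarchical_dof \<kappa>1 \<kappa>2 Q F T V L)
    \<le> 2 * real CARD('n) * C * D * ((real L + 1) * q ^ L)"
proof -
  let ?dof = "\<lambda>l x i. dof (hierarchical_problem \<kappa>1 \<kappa>2 Q F V L l x i)"
  have level: "real (\<Sum>x\<in>level_points T l. \<Sum>i\<in>UNIV. ?dof l x i)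
      \<le> 2 * real CARD('n) * C * D * q ^ L" if l: "l \<le> L" for l
  proof -
    obtain B where "finite B" "V (L - l) = span B" using spanned[of "L - l"] by auto
    note each = dof_hierarchical_problem_le[of B V L l, OF this]
    have "(\<Sum>x\<in>level_points T l. \<Sum>i\<in>UNIV. ?dof l x i)
        \<le> (\<Sum>x\<in>level_points T l. \<Sum>i\<in>(UNIV::'n set). 2 * dim (V (L - l)))"
      by (intro sum_mono each)
    then have "real (\<Sum>x\<in>level_points T l. \<Sum>i\<in>UNIV. ?dof l x i)
        \<le> real (\<Sum>x\<in>level_points T l. \<Sum>i\<in>(UNIV::'n set). 2 * dim (V (L - l)))"
      by (rule of_nat_mono)
    also have "\<dots> = 2 * real CARD('n) * (real (card (level_points T l)) * real (dim (V (L - l))))"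
      by simp
    also have "\<dots> \<le> 2 * real CARD('n) * ((C * q ^ l) * (D * q ^ (L - l)))"
      using points[OF l] dims[of "L - l"] assms(1,2) by (intro mult_left_mono mult_mono) auto
    also have "\<dots> = 2 * real CARD('n) * C * D * (q ^ l * q ^ (L - l))"
      by (simp only: mult_ac)
    also have "q ^ l * q ^ (L - l) = q ^ L"
      using l by (simp flip: power_add)
    finally show ?thesis .
  qed
  have "real (hierarchical_dof \<kappa>1 \<kappa>2 Q F T V L)
      = (\<Sum>l\<le>L. real (\<Sum>x\<in>level_points T l. \<Sum>i\<in>UNIV. ?dof l x i))"
    by (simp add: hierarchical_dof_def)
  also have "\<dots> \<le> (\<Sum>l\<le>L. 2 * real CARD('n) * C * D * q ^ L)"
    by (rule sum_mono) (use level in auto)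
  also have "\<dots> = 2 * real CARD('n) * C * D * ((real L + 1) * q ^ L)"
    by (simp add: algebra_simps)
  finally show ?thesis .
qed

text \<open>One factor \<open>q\<^sup>L\<close> comes from the geometric sum of the numbers of points, the other from the
  finest trial space. The constant \<open>4\<close> is \<open>2\<close> for the pair of components times \<open>2\<close> for the
  geometric sum.\<close>

lemma full_dof_le:
  fixes V :: "nat \<Rightarrow> ('n::finite) H1_per set" and q :: real
  assumes "q \<ge> 2" "C \<ge> 0"
    and points: "\<And>l. l \<le> L \<Longrightarrow> real (card (level_points T l)) \<le> C * q ^ l"
    and spanned: "\<exists>B. finite B \<and> V L = span B"
    and dims: "real (dim (V L)) \<le> D * q ^ L"
  shows "real (full_dof \<kappa>1 \<kappa>2 Q T V L) \<le> 4 * real CARD('n) * C * D * (q ^ L) ^ 2"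
proof -
  let ?S = "\<Union>l\<le>L. level_points T l"
  obtain B where "finite B" "V L = span B" using spanned by auto
  note each = dof_cell_galerkin_le[OF this]
  have "card ?S \<le> (\<Sum>l\<le>L. card (level_points T l))"
    by (rule card_UN_le) simp
  then have "real (card ?S) \<le> real (\<Sum>l\<le>L. card (level_points T l))"
    by (rule of_nat_mono)
  also have "\<dots> \<le> (\<Sum>l\<le>L. C * q ^ l)"
    unfolding of_nat_sum by (rule sum_mono) (use points in auto)
  also have "\<dots> \<le> C * (2 * q ^ L)"
    unfolding sum_distrib_left[symmetric]
    by (intro mult_left_mono sum_powers_le_twice_last assms(1,2))
  finally have card_S: "real (card ?S) \<le> C * (2 * q ^ L)" .
  have "full_dof \<kappa>1 \<kappa>2 Q T V L \<le> (\<Sum>x\<in>?S. \<Sum>i\<in>(UNIV::'n set). 2 * dim (V L))"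
    unfolding full_dof_def by (intro sum_mono each)
  then have "real (full_dof \<kappa>1 \<kappa>2 Q T V L) \<le> real (\<Sum>x\<in>?S. \<Sum>i\<in>(UNIV::'n set). 2 * dim (V L))"
    by (rule of_nat_mono)
  also have "\<dots> = 2 * real CARD('n) * (real (card ?S) * real (dim (V L)))"
    by simp
  also have "\<dots> \<le> 2 * real CARD('n) * ((C * (2 * q ^ L)) * (D * q ^ L))"
    using card_S dims assms(1,2) by (intro mult_left_mono mult_mono) auto
  also have "\<dots> = 4 * real CARD('n) * C * D * (q ^ L) ^ 2"
    by (simp add: power2_eq_square)
  finally show ?thesis .
qed

theorem theorem3p10:
  fixes \<Omega> :: "(real ^ 'n::finite) set"
    and H :: real
    and T :: "nat \<Rightarrow> nat \<Rightarrow> (real ^ 'n) set"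
    and V :: "nat \<Rightarrow> nat \<Rightarrow> 'n H1_per set"
    and \<kappa>1 \<kappa>2 :: "real ^ 'n \<Rightarrow> real ^ 'n \<Rightarrow> real ^ 'n ^ 'n"
    and Q :: "real ^ 'n \<Rightarrow> real ^ 'n \<Rightarrow> real"
    and F :: "nat \<Rightarrow> nat \<Rightarrow> real ^ 'n \<Rightarrow> 'n \<Rightarrow> 'n H1_per \<times> 'n H1_per \<Rightarrow> real"
  assumes dim23: "CARD('n) = 2 \<or> CARD('n) = 3"
    and spacing_pos: "H > 0"
    and grid_subset: "\<And>L l. l \<le> L \<Longrightarrow> T L l \<subseteq> \<Omega>"
    and grid_nested: "\<And>L l. l < L \<Longrightarrow> T L l \<subseteq> T L (Suc l)"
    and grid_spacing: "\<And>L l. l \<le> L \<Longrightarrow> has_grid_spacing (T L l) (H / 2 ^ l)"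
    and points_finite: "\<And>L l. l \<le> L \<Longrightarrow> finite (level_points (T L) l)"
    and points_card: "\<exists>C. \<forall>L l. l \<le> L \<longrightarrow>
           real (card (level_points (T L) l)) \<le> C * 2 ^ (CARD('n) * l)"
    and fe_subspace: "\<And>L m. m \<le> L \<Longrightarrow> subspace (V L m)"
    and fe_nested: "\<And>L m. m < L \<Longrightarrow> V L m \<subseteq> V L (Suc m)"
    and fe_finite_dim: "\<And>L m. m \<le> L \<Longrightarrow> \<exists>B. finite B \<and> V L m = span B"
    and fe_dim: "\<exists>C. \<forall>L m. m \<le> L \<longrightarrow> real (dim (V L m)) \<le> C * 2 ^ (CARD('n) * m)"
  shows "(\<exists>C. \<forall>L. real (hierarchical_dof \<kappa>1 \<kappa>2 Q (F L) (T L) (V L) L)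
            \<le> C * ((real L + 1) * 2 ^ (CARD('n) * L))) \<and>
         (\<exists>C. \<forall>L. real (full_dof \<kappa>1 \<kappa>2 Q (T L) (V L) L)
            \<le> C * (2 ^ (CARD('n) * L)) ^ 2)"
proof -
  define q :: real where "q = 2 ^ CARD('n)"
  have q: "2 ^ (CARD('n) * m) = q ^ m" for m by (simp add: q_def power_mult)
  have "(2::real) ^ 1 \<le> 2 ^ CARD('n)" by (intro power_increasing) (auto simp: Suc_le_eq)
  then have q2: "q \<ge> 2" by (simp add: q_def)
  obtain C where C: "\<And>L l. l \<le> L \<Longrightarrow> real (card (level_points (T L) l)) \<le> C * q ^ l"
    using points_card unfolding q by blast
  obtain D where D: "\<And>L m. m \<le> L \<Longrightarrow> real (dim (V L m)) \<le> D * q ^ m"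
    using fe_dim unfolding q by blast
  \<comment> \<open>The constant is itself an upper bound for the number of points of the coarsest level.\<close>
  have "C \<ge> 0" using order_trans[OF of_nat_0_le_iff C[of 0 0]] by simp
  then have "real (hierarchical_dof \<kappa>1 \<kappa>2 Q (F L) (T L) (V L) L)
        \<le> 2 * real CARD('n) * C * D * ((real L + 1) * q ^ L)"
      "real (full_dof \<kappa>1 \<kappa>2 Q (T L) (V L) L) \<le> 4 * real CARD('n) * C * D * (q ^ L) ^ 2" for L
    using q2 C D fe_finite_dim by (auto intro!: hierarchical_dof_le full_dof_le)
  then show ?thesis unfolding q by blast
qed

end
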